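(* Let $\lambda>0$, $T>0$, $\Delta t=T/N$, $t_n=n\Delta t$, $a\in\mathbb{R}$ and $s=a\Delta t^2$. Let $u$ solve $\ddot u+\lambda u=0$ with $u(0)=\widehat u_0$, $\dot u(0)=\widehat u_1$. Consider the $\mathbb{P}^1$-DG scheme $\bm u_{n+1}=G\bm u_n$, $n=0,\dots,N-1$, with $$G=\begin{bmatrix}0&1\\ \frac{2+\lambda s}{\lambda s-\Delta t^2\lambda-2}&\frac{\Delta t^2\lambda-4}{\lambda s-\Delta t^2\lambda-2}\end{bmatrix},$$ let $\bm u_n^{ex}=(u(t_{n-1}),u(t_n))^\top$, $\bm e_n=\bm u_n^{ex}-\bm u_n$ with $\bm e_0=\bm 0$, and $\bm\theta_n=\bm u_{n+1}^{ex}-G\bm u_n^{ex}$, so that $\bm e_{n+1}=G\bm e_n+\bm\theta_n$. Let $G=WDW^{-1}$ with $$W=\begin{bmatrix}1&1\\ \lambda_1&\lambda_2\end{bmatrix},\quad D=\begin{bmatrix}\lambda_1&0\\0&\lambda_2\end{bmatrix},\quad \lambda_{1,2}=\frac{\pm\Delta t\sqrt{(4a^2-4a+1)\Delta t^2\lambda^2-16\lambda}+\Delta t^2\lambda-4}{2(a-1)\Delta t^2\lambda-4}.$$ Then $$\bm\theta_n=O(\Delta t^{p+1}),\qquad W^{-1}\bm\theta_n=O(\Delta t^{p}),\qquad \bm e_n=O(\Delta t^{p-1}),$$ with $p=2$ for $a\in\{0\}\cup\bigl(\tfrac12-\tfrac{2}{\Delta t\sqrt\lambda},\tfrac12\bigr)$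 and $p=3$ for $a=\tfrac12$.
   Context: $O(\cdot)$ is for $\Delta t\to0$ with $a,\lambda,T,\widehat u_0,\widehat u_1$ fixed, uniformly in $n=0,\dots,N-1$ (respectively $n=0,\dots,N$ for $\bm e_n$). For $n=0$ the value $u(t_{-1})=u(-\Delta t)$ refers to the solution of the ODE extended to $\mathbb{R}$. Square roots of negative numbers are complex. Origin of the scheme: with $I_n=(t_{n-1},t_n]$, the approximation $u_{DG}$ has degree $\le1$ on each $I_n$, with $\bm u_n=(u_{DG}(t_{n-1}^+),u_{DG}(t_n^-))^\top$, and satisfies for all $v\in\mathbb{P}^1(I_{n+1})$: $\int_{I_{n+1}}\ddot u_{DG}\dot v+\lambda\int_{I_{n+1}}u_{DG}\dot v+[\dot u_{DG}]_n\dot v(t_n^+)+\lambda[u_{DG}]_nv(t_n^+)-s\lambda\{\dot u_{DG}\}_n\dot v(t_n^+)=0$, where $[\cdot]_n$ denotes the jump (right minus left value) and $\{\cdot\}_n$ the average at $t_n$. *)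

theory Defs
  imports "HOL-Analysis.Analysis" "HOL-Library.Landau_Symbols"
begin

text \<open>Throughout, \<open>lam\<close> is the coefficient of the equation \<open>u'' + lam * u = 0\<close>, \<open>h\<close> is the time step,
  \<open>s\<close> is the parameter of the scheme, and \<open>a = s / h\<^sup>2\<close>.\<close>

definition dg_G :: "real \<Rightarrow> real \<Rightarrow> real \<Rightarrow> real^2^2" where
  "dg_G lam h s = vector
     [vector [0, 1],
      vector [(2 + lam * s) / (lam * s - h\<^sup>2 * lam - 2), (h\<^sup>2 * lam - 4) / (lam * s - h\<^sup>2 * lam - 2)]]"

text \<open>The grid is \<open>t\<^sub>n = n * h\<close>; the index \<open>n - 1\<close> is taken in the reals, so that \<open>t\<close> at index
  \<open>-1\<close> is \<open>-h\<close>.\<close>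

definition u_ex :: "(real \<Rightarrow> real) \<Rightarrow> real \<Rightarrow> nat \<Rightarrow> real^2" where
  "u_ex u h n = vector [u ((real n - 1) * h), u (real n * h)]"

definition dg_sqrt_disc :: "real \<Rightarrow> real \<Rightarrow> real \<Rightarrow> complex" where
  "dg_sqrt_disc lam h a = csqrt (of_real ((4 * a\<^sup>2 - 4 * a + 1) * h\<^sup>2 * lam\<^sup>2 - 16 * lam))"

definition dg_lambda1 :: "real \<Rightarrow> real \<Rightarrow> real \<Rightarrow> complex" where
  "dg_lambda1 lam h a =
     (of_real h * dg_sqrt_disc lam h a + of_real (h\<^sup>2 * lam - 4)) / of_real (2 * (a - 1) * h\<^sup>2 * lam - 4)"

definition dg_lambda2 :: "real \<Rightarrow> real \<Rightarrow> real \<Rightarrow> complex" where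
  "dg_lambda2 lam h a =
     (- of_real h * dg_sqrt_disc lam h a + of_real (h\<^sup>2 * lam - 4)) / of_real (2 * (a - 1) * h\<^sup>2 * lam - 4)"

definition dg_W :: "real \<Rightarrow> real \<Rightarrow> real \<Rightarrow> complex^2^2" where
  "dg_W lam h a = vector [vector [1, 1], vector [dg_lambda1 lam h a, dg_lambda2 lam h a]]"

definition dg_D :: "real \<Rightarrow> real \<Rightarrow> real \<Rightarrow> complex^2^2" where
  "dg_D lam h a = vector [vector [dg_lambda1 lam h a, 0], vector [0, dg_lambda2 lam h a]]"

definition complex_vec :: "real^'n \<Rightarrow> complex^'n" where
  "complex_vec x = (\<chi> i. complex_of_real (x $ i))"

end

theory Submission
  imports Defs
begin

text \<open>
  Consistency: multiplied by the denominator of \<open>dg_G\<close>, the truncation error is a combination of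
  \<open>u\<close> at three neighbouring grid points. Taylor expansion, with all derivatives reduced to \<open>u\<close> and
  \<open>u'\<close> by the differential equation, leaves \<open>(2 * a - 1) * lam * h\<^sup>3 * u'\<close> plus a remainder of order
  \<open>h\<^sup>4\<close> that is uniform in time because conservation of energy bounds \<open>u\<close> and \<open>u'\<close> on the whole line
  (\<open>truncation_error\<close>).

  Stability: \<open>dg_G\<close> is a companion matrix, so its eigenvalues are the roots of a real quadratic. For
  small \<open>h\<close> the discriminant is negative and they are conjugate; the square of their modulus is then
  their product, a quotient that is at most one exactly when \<open>a \<le> 1/2\<close> (\<open>norm_dg_lambda_le_1\<close>).
  Their distance is bounded below by a multiple of \<open>h\<close> (\<open>dg_lambda_separated\<close>), and a truncation
  error, whose first component is zero, has eigenbasis coordinates of size \<open>\<bar>\<theta>\<bar>\<close> over this distance.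
  Hence \<open>W\<inverse>\<close> costs one order (\<open>dg_W_inv_bound\<close>).

  Convergence: in the eigenbasis the error recursion is diagonal with entries of modulus at most one,
  so the \<open>N = T / h\<close> local contributions add up without amplification (\<open>dg_error_bound\<close>), which costs
  the second order. Mapping back by \<open>W\<close> costs nothing, as its entries are bounded by one.
\<close>

section \<open>Solutions of the harmonic oscillator\<close>

text \<open>The energy \<open>u'\<^sup>2 + lam * u\<^sup>2\<close> is conserved; it controls \<open>u\<close> because \<open>lam > 0\<close>.\<close>

lemma oscillator_bounded:
  fixes u u' u'' :: "real \<Rightarrow> real"
  assumes "lam > 0"
    and du: "\<And>t. (u has_real_derivative u' t) (at t)"
    and du': "\<And>t. (u' has_real_derivative u'' t) (at t)"
    and ode: "\<And>t. u'' t + lam * u t = 0"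
  obtains M where "\<And>t. \<bar>u t\<bar> \<le> M" "\<And>t. \<bar>u' t\<bar> \<le> M"
proof -
  define E where "E = (\<lambda>t. (u' t)\<^sup>2 + lam * (u t)\<^sup>2)"
  have u'': "u'' t = - lam * u t" for t
    using ode[of t] by linarith
  have "(E has_real_derivative 0) (at t)" for t
    unfolding E_def
    by (rule derivative_eq_intros du du' refl)+ (simp add: u'' algebra_simps)
  then have const: "E t = E 0" for t
    by (intro DERIV_isconst_all allI)
  have "(u' t)\<^sup>2 \<le> E 0" for t
    using \<open>lam > 0\<close> unfolding const[of t, symmetric] by (simp add: E_def)
  then have bound_u': "\<bar>u' t\<bar> \<le> sqrt (E 0)" for t
    by (intro real_le_rsqrt) simp
  have "(u t)\<^sup>2 * lam \<le> E 0" for t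
    unfolding const[of t, symmetric] by (simp add: E_def)
  then have bound_u: "\<bar>u t\<bar> \<le> sqrt (E 0 / lam)" for t
    using \<open>lam > 0\<close> by (intro real_le_rsqrt) (simp add: pos_le_divide_eq)
  show thesis
    by (rule that[of "max (sqrt (E 0)) (sqrt (E 0 / lam))"])
       (use bound_u bound_u' in \<open>auto simp: le_max_iff_disj\<close>)
qed

text \<open>The differential equation turns every derivative of \<open>u\<close> into a multiple of \<open>u\<close> or \<open>u'\<close>, so
  that the Taylor expansion, remainder included, involves no others. The step \<open>k\<close> may be
  negative.\<close>

lemma oscillator_taylor:
  fixes u u' u'' :: "real \<Rightarrow> real"
  assumes du: "\<And>t. (u has_real_derivative u' t) (at t)"
    and du': "\<And>t. (u' has_real_derivative u'' t) (at t)"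
    and ode: "\<And>t. u'' t + lam * u t = 0"
  obtains \<tau> where
    "u (t + k) = u t + k * u' t - lam * k\<^sup>2 / 2 * u t - lam * k ^ 3 / 6 * u' t + lam\<^sup>2 * k ^ 4 / 24 * u \<tau>"
proof -
  have u'': "u'' t = - lam * u t" for t
    using ode[of t] by linarith
  define diff where
    "diff = (\<lambda>m x. (- lam) ^ (m div 2) * (if even m then u (t + x) else u' (t + x)))"
  have "(diff m has_real_derivative diff (Suc m) x) (at x)" for m x
  proof (cases "even m")
    case True
    have "((\<lambda>x. u (t + x)) has_real_derivative u' (t + x)) (at x)"
      using du[of "x + t"] DERIV_shift[of u "u' (x + t)" x t] by (simp add: add.commute)
    from DERIV_cmult[OF this, of "(- lam) ^ (m div 2)"] True show ?thesis
      by (simp add: diff_def)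
  next
    case False
    have "((\<lambda>x. u' (t + x)) has_real_derivative u'' (t + x)) (at x)"
      using du'[of "x + t"] DERIV_shift[of u' "u'' (x + t)" x t] by (simp add: add.commute)
    from DERIV_cmult[OF this, of "(- lam) ^ (m div 2)"] False show ?thesis
      by (simp add: diff_def u'' mult_ac)
  qed
  moreover have "diff 0 = (\<lambda>x. u (t + x))"
    by (simp add: diff_def)
  ultimately obtain \<xi> where
    "u (t + k) = (\<Sum>m<4. diff m 0 / fact m * k ^ m) + diff 4 \<xi> / fact 4 * k ^ 4"
    using Maclaurin_all_le[of diff "\<lambda>x. u (t + x)" k 4] by auto
  moreover have "(\<Sum>m<4. diff m 0 / fact m * k ^ m) =
      u t + k * u' t - lam * k\<^sup>2 / 2 * u t - lam * k ^ 3 / 6 * u' t"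
    by (simp add: diff_def lessThan_nat_numeral lessThan_Suc fact_numeral mult_ac)
  moreover have "diff 4 \<xi> / fact 4 * k ^ 4 = lam\<^sup>2 * k ^ 4 / 24 * u (t + \<xi>)"
    by (simp add: diff_def fact_numeral)
  ultimately have "u (t + k) = u t + k * u' t - lam * k\<^sup>2 / 2 * u t - lam * k ^ 3 / 6 * u' t
      + lam\<^sup>2 * k ^ 4 / 24 * u (t + \<xi>)"
    by simp
  then show thesis
    by (rule that)
qed

section \<open>Consistency\<close>

text \<open>The \<open>h\<^sup>2\<close> terms of the multiplied-out truncation error cancel by the differential equation and
  what remains has leading part \<open>(2 * a - 1) * lam * h\<^sup>3 * u'\<close>. The value \<open>a = 1/2\<close> removes it,
  which is where the extra order comes from.\<close>

lemma truncation_numerator: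
  fixes u u' u'' :: "real \<Rightarrow> real"
  assumes "lam > 0"
    and du: "\<And>t. (u has_real_derivative u' t) (at t)"
    and du': "\<And>t. (u' has_real_derivative u'' t) (at t)"
    and ode: "\<And>t. u'' t + lam * u t = 0"
  obtains C where "\<And>h t. 0 < h \<Longrightarrow> h \<le> 1 \<Longrightarrow>
    \<bar>((a - 1) * h\<^sup>2 * lam - 2) * u (t + h) - (2 + lam * a * h\<^sup>2) * u (t - h) - (h\<^sup>2 * lam - 4) * u t
      - (2 * a - 1) * lam * h ^ 3 * u' t\<bar> \<le> C * h ^ 4"
proof -
  obtain M where M: "\<And>t. \<bar>u t\<bar> \<le> M" "\<And>t. \<bar>u' t\<bar> \<le> M"
    using oscillator_bounded[OF assms] by metis
  define C where "C = lam\<^sup>2 / 2 * M + lam\<^sup>2 * \<bar>2 * a - 1\<bar> / 6 * M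
    + (\<bar>lam\<bar> * \<bar>a - 1\<bar> + 2) * lam\<^sup>2 / 24 * M + (\<bar>lam\<bar> * \<bar>a\<bar> + 2) * lam\<^sup>2 / 24 * M"
  show thesis
  proof (rule that[of C])
    fix h t :: real
    assume h: "0 < h" "h \<le> 1"
    obtain \<tau> where \<tau>: "u (t + h) =
        u t + h * u' t - lam * h\<^sup>2 / 2 * u t - lam * h ^ 3 / 6 * u' t + lam\<^sup>2 * h ^ 4 / 24 * u \<tau>"
      using oscillator_taylor[OF du du' ode] by blast
    obtain \<sigma> where "u (t + - h) = u t + - h * u' t - lam * (- h)\<^sup>2 / 2 * u t
        - lam * (- h) ^ 3 / 6 * u' t + lam\<^sup>2 * (- h) ^ 4 / 24 * u \<sigma>"
      using oscillator_taylor[OF du du' ode] by blast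
    then have \<sigma>: "u (t - h) =
        u t - h * u' t - lam * h\<^sup>2 / 2 * u t + lam * h ^ 3 / 6 * u' t + lam\<^sup>2 * h ^ 4 / 24 * u \<sigma>"
      by simp
    define Q where "Q = lam\<^sup>2 / 2 * u t - lam\<^sup>2 * (2 * a - 1) * h / 6 * u' t
      + (lam * (a - 1) * h\<^sup>2 - 2) * lam\<^sup>2 / 24 * u \<tau> - (lam * a * h\<^sup>2 + 2) * lam\<^sup>2 / 24 * u \<sigma>"
    have expansion: "((a - 1) * h\<^sup>2 * lam - 2) * u (t + h) - (2 + lam * a * h\<^sup>2) * u (t - h)
      - (h\<^sup>2 * lam - 4) * u t - (2 * a - 1) * lam * h ^ 3 * u' t = Q * h ^ 4"
      unfolding \<tau> \<sigma> Q_def by (simp add: field_simps eval_nat_numeral)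
    have h2: "h\<^sup>2 \<le> 1"
      using h by (simp add: power_le_one)
    have "\<bar>lam\<^sup>2 / 2 * u t\<bar> \<le> lam\<^sup>2 / 2 * M"
      using M by (simp add: abs_mult mult_left_mono)
    moreover have "\<bar>lam\<^sup>2 * (2 * a - 1) * h / 6 * u' t\<bar> \<le> lam\<^sup>2 * \<bar>2 * a - 1\<bar> / 6 * M"
    proof -
      have "\<bar>lam\<^sup>2 * (2 * a - 1) * h / 6 * u' t\<bar> = lam\<^sup>2 * \<bar>2 * a - 1\<bar> * h / 6 * \<bar>u' t\<bar>"
        using h by (simp add: abs_mult)
      also have "\<dots> \<le> lam\<^sup>2 * \<bar>2 * a - 1\<bar> * 1 / 6 * M"
        using h M by (intro mult_mono divide_right_mono) auto
      finally show ?thesis by simp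
    qed
    moreover have "\<bar>(lam * (a - 1) * h\<^sup>2 - 2) * lam\<^sup>2 / 24 * u \<tau>\<bar>
        \<le> (\<bar>lam\<bar> * \<bar>a - 1\<bar> + 2) * lam\<^sup>2 / 24 * M"
    proof -
      have "\<bar>lam * (a - 1) * h\<^sup>2 - 2\<bar> \<le> \<bar>lam * (a - 1)\<bar> * h\<^sup>2 + 2"
        by (metis abs_mult abs_numeral abs_power2 abs_triangle_ineq4)
      also have "\<dots> \<le> \<bar>lam * (a - 1)\<bar> * 1 + 2"
        using h2 by (intro add_right_mono mult_left_mono) auto
      finally have "\<bar>lam * (a - 1) * h\<^sup>2 - 2\<bar> \<le> \<bar>lam\<bar> * \<bar>a - 1\<bar> + 2"
        by (simp add: abs_mult)
      then show ?thesis
        using M(1)[of \<tau>] by (auto simp: abs_mult intro!: mult_mono divide_right_mono)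
    qed
    moreover have "\<bar>(lam * a * h\<^sup>2 + 2) * lam\<^sup>2 / 24 * u \<sigma>\<bar> \<le> (\<bar>lam\<bar> * \<bar>a\<bar> + 2) * lam\<^sup>2 / 24 * M"
    proof -
      have "\<bar>lam * a * h\<^sup>2 + 2\<bar> \<le> \<bar>lam * a\<bar> * h\<^sup>2 + 2"
        by (metis abs_mult abs_numeral abs_power2 abs_triangle_ineq)
      also have "\<dots> \<le> \<bar>lam * a\<bar> * 1 + 2"
        using h2 by (intro add_right_mono mult_left_mono) auto
      finally have "\<bar>lam * a * h\<^sup>2 + 2\<bar> \<le> \<bar>lam\<bar> * \<bar>a\<bar> + 2"
        by (simp add: abs_mult)
      then show ?thesis
        using M(1)[of \<sigma>] by (auto simp: abs_mult intro!: mult_mono divide_right_mono)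
    qed
    moreover have "\<bar>w - x + y - z\<bar> \<le> A + B + D + F"
      if "\<bar>w\<bar> \<le> A" "\<bar>x\<bar> \<le> B" "\<bar>y\<bar> \<le> D" "\<bar>z\<bar> \<le> F" for w x y z A B D F :: real
      using that by linarith
    ultimately have "\<bar>Q\<bar> \<le> C"
      unfolding Q_def C_def by blast
    then show "\<bar>((a - 1) * h\<^sup>2 * lam - 2) * u (t + h) - (2 + lam * a * h\<^sup>2) * u (t - h)
        - (h\<^sup>2 * lam - 4) * u t - (2 * a - 1) * lam * h ^ 3 * u' t\<bar> \<le> C * h ^ 4"
      unfolding expansion using h by (simp add: abs_mult mult_right_mono)
  qed
qed

lemma dg_G_mult_vec:
  "dg_G lam h s *v x = vector [x $ 2,
     ((2 + lam * s) * x $ 1 + (h\<^sup>2 * lam - 4) * x $ 2) / (lam * s - h\<^sup>2 * lam - 2)]"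
  by (simp add: vec_eq_iff forall_2 dg_G_def matrix_vector_mult_def sum_2
      add_divide_distrib distrib_right)

text \<open>For \<open>a \<le> 1/2\<close> the denominator of the scheme stays away from zero, so dividing by it costs no
  order.\<close>

lemma dg_denominator_le:
  fixes a h lam :: real
  assumes "lam > 0" "a \<le> 1/2"
  shows "(a - 1) * h\<^sup>2 * lam - 2 \<le> - 2"
  using assms by (simp add: mult_nonpos_nonneg)

text \<open>For \<open>p = 2\<close> the leading term \<open>(2 * a - 1) * lam * h\<^sup>3 * u'\<close> dominates the remainder as
  \<open>h\<^sup>4 \<le> h\<^sup>3\<close>; for \<open>p = 3\<close> only the remainder is present.\<close>

lemma truncation_error:
  fixes u u' u'' :: "real \<Rightarrow> real"
  assumes "lam > 0"
    and du: "\<And>t. (u has_real_derivative u' t) (at t)"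
    and du': "\<And>t. (u' has_real_derivative u'' t) (at t)"
    and ode: "\<And>t. u'' t + lam * u t = 0"
    and p: "p = 2 \<and> a \<le> 1/2 \<or> p = 3 \<and> a = 1/2"
  obtains C where "\<And>h n. 0 < h \<Longrightarrow> h \<le> 1 \<Longrightarrow>
    norm (u_ex u h (Suc n) - dg_G lam h (a * h\<^sup>2) *v u_ex u h n) \<le> C * h ^ (p + 1)"
proof -
  obtain M where M: "\<And>t. \<bar>u t\<bar> \<le> M" "\<And>t. \<bar>u' t\<bar> \<le> M"
    using oscillator_bounded[OF assms(1-4)] by metis
  obtain C where C: "\<And>h t. 0 < h \<Longrightarrow> h \<le> 1 \<Longrightarrow>
    \<bar>((a - 1) * h\<^sup>2 * lam - 2) * u (t + h) - (2 + lam * a * h\<^sup>2) * u (t - h) - (h\<^sup>2 * lam - 4) * u t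
      - (2 * a - 1) * lam * h ^ 3 * u' t\<bar> \<le> C * h ^ 4"
    using truncation_numerator[OF assms(1-4)] by metis
  show thesis
  proof (rule that[of "\<bar>2 * a - 1\<bar> * lam * M + C"])
    fix h :: real and n :: nat
    assume h: "0 < h" "h \<le> 1"
    define t where "t = real n * h"
    define d where "d = (a - 1) * h\<^sup>2 * lam - 2"
    define y where "y = d * u (t + h) - (2 + lam * a * h\<^sup>2) * u (t - h) - (h\<^sup>2 * lam - 4) * u t"
    have "d \<le> - 2"
      unfolding d_def using p \<open>lam > 0\<close> by (intro dg_denominator_le) auto
    have grid: "(real n - 1) * h = t - h" "real n * h = t" "(1 + real n) * h = t + h"
      by (simp_all add: t_def algebra_simps)
    have d: "lam * (a * h\<^sup>2) - h\<^sup>2 * lam - 2 = d"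
      by (simp add: d_def algebra_simps)
    have u_n: "u_ex u h n = vector [u (t - h), u t]"
      and u_Suc: "u_ex u h (Suc n) = vector [u t, u (t + h)]"
      by (simp_all add: u_ex_def grid)
    have vec: "u_ex u h (Suc n) - dg_G lam h (a * h\<^sup>2) *v u_ex u h n = vector [0, y / d]"
      using \<open>d \<le> - 2\<close> unfolding dg_G_mult_vec u_n u_Suc d
      by (simp add: vec_eq_iff forall_2 y_def field_simps)
    have "norm (vector [0, y / d] :: real^2) = \<bar>y / d\<bar>"
      by (simp add: norm_vec_def L2_set_def sum_2)
    also have "\<dots> \<le> \<bar>y\<bar> / 1"
      unfolding abs_divide using \<open>d \<le> - 2\<close> by (intro divide_left_mono) auto
    also have "\<bar>y\<bar> / 1 \<le> \<bar>2 * a - 1\<bar> * lam * M * h ^ 3 + C * h ^ 4"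
    proof -
      have "\<bar>(2 * a - 1) * lam * h ^ 3 * u' t\<bar> = \<bar>2 * a - 1\<bar> * lam * h ^ 3 * \<bar>u' t\<bar>"
        using h \<open>lam > 0\<close> by (simp add: abs_mult)
      also have "\<dots> \<le> \<bar>2 * a - 1\<bar> * lam * h ^ 3 * M"
        using h \<open>lam > 0\<close> M by (intro mult_left_mono) auto
      finally show ?thesis
        using C[OF h, of t] by (simp add: y_def d_def mult_ac)
    qed
    also have "\<dots> \<le> (\<bar>2 * a - 1\<bar> * lam * M + C) * h ^ (p + 1)"
    proof -
      have "0 \<le> C * h ^ 4"
        using C[OF h, of t] by linarith
      then have "0 \<le> C"
        using h by (simp add: zero_le_mult_iff)
      moreover have "h ^ 4 \<le> h ^ 3"
        using h by (intro power_decreasing) auto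
      ultimately have "C * h ^ 4 \<le> C * h ^ 3"
        by (rule mult_left_mono[rotated])
      then show ?thesis
        using p by (auto simp: algebra_simps eval_nat_numeral)
    qed
    finally show "norm (u_ex u h (Suc n) - dg_G lam h (a * h\<^sup>2) *v u_ex u h n)
        \<le> (\<bar>2 * a - 1\<bar> * lam * M + C) * h ^ (p + 1)"
      by (simp add: vec)
  qed
qed

section \<open>Eigenvalues of the propagation matrix\<close>

text \<open>Vieta's formulas for the characteristic polynomial of \<open>dg_G\<close>: the companion matrix depends on
  its eigenvalues only through their sum and product, which are free of the square root.\<close>

lemma dg_lambda_sum_prod:
  assumes d: "(a - 1) * h\<^sup>2 * lam - 2 \<noteq> 0"
  shows "dg_lambda1 lam h a + dg_lambda2 lam h a =
      of_real ((h\<^sup>2 * lam - 4) / ((a - 1) * h\<^sup>2 * lam - 2))"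
    and "dg_lambda1 lam h a * dg_lambda2 lam h a =
      - of_real ((2 + lam * a * h\<^sup>2) / ((a - 1) * h\<^sup>2 * lam - 2))"
proof -
  define d where "d = (a - 1) * h\<^sup>2 * lam - 2"
  define b where "b = h\<^sup>2 * lam - 4"
  define S where "S = dg_sqrt_disc lam h a"
  have "d \<noteq> 0"
    using d by (simp add: d_def)
  have two_d: "2 * (a - 1) * h\<^sup>2 * lam - 4 = 2 * d"
    by (simp add: d_def)
  have "S\<^sup>2 = of_real ((4 * a\<^sup>2 - 4 * a + 1) * h\<^sup>2 * lam\<^sup>2 - 16 * lam)"
    unfolding S_def dg_sqrt_disc_def by (rule power2_csqrt)
  then have disc: "(of_real h * S)\<^sup>2 = of_real (h\<^sup>2 * ((4 * a\<^sup>2 - 4 * a + 1) * h\<^sup>2 * lam\<^sup>2 - 16 * lam))"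
    by (simp only: power_mult_distrib of_real_mult of_real_power)
  have l1: "dg_lambda1 lam h a = (of_real h * S + of_real b) / of_real (2 * d)"
    unfolding dg_lambda1_def S_def b_def two_d ..
  have l2: "dg_lambda2 lam h a = (- (of_real h * S) + of_real b) / of_real (2 * d)"
    unfolding dg_lambda2_def S_def b_def two_d by simp
  have "dg_lambda1 lam h a + dg_lambda2 lam h a = of_real (b / d)"
    using \<open>d \<noteq> 0\<close> unfolding l1 l2 by (simp add: field_simps)
  then show "dg_lambda1 lam h a + dg_lambda2 lam h a =
      of_real ((h\<^sup>2 * lam - 4) / ((a - 1) * h\<^sup>2 * lam - 2))"
    by (simp add: b_def d_def)
  have "dg_lambda1 lam h a * dg_lambda2 lam h a =
      ((of_real b)\<^sup>2 - (of_real h * S)\<^sup>2) / (of_real (2 * d))\<^sup>2"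
    unfolding l1 l2 by (simp add: power2_eq_square algebra_simps)
  also have "\<dots> = of_real
      ((b\<^sup>2 - h\<^sup>2 * ((4 * a\<^sup>2 - 4 * a + 1) * h\<^sup>2 * lam\<^sup>2 - 16 * lam)) / (2 * d)\<^sup>2)"
    unfolding disc by simp
  also have "b\<^sup>2 - h\<^sup>2 * ((4 * a\<^sup>2 - 4 * a + 1) * h\<^sup>2 * lam\<^sup>2 - 16 * lam) =
      - (4 * d * (2 + lam * a * h\<^sup>2))"
    unfolding b_def d_def by algebra
  also have "- (4 * d * (2 + lam * a * h\<^sup>2)) / (2 * d)\<^sup>2 = - ((2 + lam * a * h\<^sup>2) / d)"
    using \<open>d \<noteq> 0\<close> by (simp add: power2_eq_square)
  finally show "dg_lambda1 lam h a * dg_lambda2 lam h a =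
      - of_real ((2 + lam * a * h\<^sup>2) / ((a - 1) * h\<^sup>2 * lam - 2))"
    by (simp add: d_def)
qed

text \<open>A nonpositive discriminant makes the eigenvalues complex conjugates, so their product
  \<open>(2 + lam * a * h\<^sup>2) / (2 + lam * (1 - a) * h\<^sup>2)\<close> is the square of their common modulus.
  That this is at most one is the condition \<open>a \<le> 1/2\<close>.\<close>

lemma norm_dg_lambda_le_1:
  assumes "lam > 0" "a \<le> 1/2" and disc: "(4 * a\<^sup>2 - 4 * a + 1) * h\<^sup>2 * lam\<^sup>2 - 16 * lam \<le> 0"
  shows "norm (dg_lambda1 lam h a) \<le> 1" "norm (dg_lambda2 lam h a) \<le> 1"
proof -
  define d where "d = (a - 1) * h\<^sup>2 * lam - 2"
  have "d \<le> - 2"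
    unfolding d_def using assms(1,2) by (rule dg_denominator_le)
  have "dg_sqrt_disc lam h a =
      \<i> * of_real (sqrt \<bar>(4 * a\<^sup>2 - 4 * a + 1) * h\<^sup>2 * lam\<^sup>2 - 16 * lam\<bar>)"
    unfolding dg_sqrt_disc_def using disc by (subst csqrt_of_real_nonpos) auto
  then have "cnj (dg_sqrt_disc lam h a) = - dg_sqrt_disc lam h a"
    by simp
  then have cnj: "dg_lambda2 lam h a = cnj (dg_lambda1 lam h a)"
    by (simp add: dg_lambda1_def dg_lambda2_def)
  have "of_real ((norm (dg_lambda1 lam h a))\<^sup>2) = dg_lambda1 lam h a * dg_lambda2 lam h a"
    unfolding cnj by (rule complex_norm_square)
  also have "\<dots> = of_real (- ((2 + lam * a * h\<^sup>2) / d))"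
    using \<open>d \<le> - 2\<close> dg_lambda_sum_prod(2)[of a h lam] by (simp add: d_def)
  finally have "(norm (dg_lambda1 lam h a))\<^sup>2 = - ((2 + lam * a * h\<^sup>2) / d)"
    by (simp only: of_real_eq_iff)
  also have "\<dots> = (2 + lam * a * h\<^sup>2) / - d"
    by simp
  also have "\<dots> \<le> 1"
  proof -
    have "0 \<le> (1 - 2 * a) * (lam * h\<^sup>2)"
      using assms(1,2) by simp
    then have "2 + lam * a * h\<^sup>2 \<le> - d"
      by (simp add: d_def algebra_simps)
    then show ?thesis
      using \<open>d \<le> - 2\<close> by (subst pos_divide_le_eq) auto
  qed
  finally show "norm (dg_lambda1 lam h a) \<le> 1"
    using abs_square_le_1[of "norm (dg_lambda1 lam h a)"] by simp
  then show "norm (dg_lambda2 lam h a) \<le> 1"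
    by (simp add: cnj)
qed

text \<open>The two eigenvalues come together as \<open>h\<close> tends to zero, but only linearly: this is the one
  order that \<open>W\<inverse>\<close> costs. The two smallness conditions on \<open>h\<close> keep the discriminant below half its
  limit \<open>- 16 * lam\<close> and the denominator between \<open>- 3\<close> and \<open>- 2\<close>.\<close>

lemma dg_lambda_separated:
  assumes "lam > 0" "a \<le> 1/2" "h > 0"
    and disc: "(4 * a\<^sup>2 - 4 * a + 1) * h\<^sup>2 * lam\<^sup>2 \<le> 8 * lam"
    and den: "(1 - a) * h\<^sup>2 * lam \<le> 1"
  shows "sqrt (8 * lam) / 3 * h \<le> norm (dg_lambda1 lam h a - dg_lambda2 lam h a)"
proof -
  define d where "d = (a - 1) * h\<^sup>2 * lam - 2"
  define S where "S = dg_sqrt_disc lam h a"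
  have "d \<le> - 2"
    unfolding d_def using assms(1,2) by (rule dg_denominator_le)
  have "- 3 \<le> d"
    using den by (simp add: d_def algebra_simps)
  have two_d: "2 * (a - 1) * h\<^sup>2 * lam - 4 = 2 * d"
    by (simp add: d_def)
  have "norm S = sqrt \<bar>(4 * a\<^sup>2 - 4 * a + 1) * h\<^sup>2 * lam\<^sup>2 - 16 * lam\<bar>"
    unfolding S_def dg_sqrt_disc_def norm_csqrt by (simp only: norm_of_real)
  then have "sqrt (8 * lam) \<le> norm S"
    using disc by simp
  have "dg_lambda1 lam h a - dg_lambda2 lam h a = of_real h * S / of_real d"
    using \<open>d \<le> - 2\<close> unfolding dg_lambda1_def dg_lambda2_def S_def[symmetric] two_d
    by (simp add: field_simps)
  then have "norm (dg_lambda1 lam h a - dg_lambda2 lam h a) = h * norm S / \<bar>d\<bar>"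
    using \<open>h > 0\<close> by (simp add: norm_divide norm_mult)
  moreover have "h * sqrt (8 * lam) / 3 \<le> h * norm S / \<bar>d\<bar>"
    using \<open>h > 0\<close> \<open>d \<le> - 2\<close> \<open>- 3 \<le> d\<close> \<open>sqrt (8 * lam) \<le> norm S\<close>
    by (intro frac_le mult_left_mono) auto
  ultimately show ?thesis
    by (simp add: mult.commute)
qed

lemma dg_W_mult_vec:
  "dg_W lam h a *v z =
     vector [z $ 1 + z $ 2, dg_lambda1 lam h a * z $ 1 + dg_lambda2 lam h a * z $ 2]"
  by (simp add: vec_eq_iff forall_2 dg_W_def matrix_vector_mult_def sum_2)

lemma dg_D_mult_vec:
  "dg_D lam h a *v z = vector [dg_lambda1 lam h a * z $ 1, dg_lambda2 lam h a * z $ 2]"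
  by (simp add: vec_eq_iff forall_2 dg_D_def matrix_vector_mult_def sum_2)

lemma invertible_dg_W:
  assumes "dg_lambda1 lam h a \<noteq> dg_lambda2 lam h a"
  shows "invertible (dg_W lam h a)"
  using assms by (simp add: invertible_det_nz det_2 dg_W_def)

lemma invertible_matrix_inv:
  assumes "invertible A"
  shows "A ** matrix_inv A = mat 1" "matrix_inv A ** A = mat 1"
  using someI_ex[OF assms[unfolded invertible_def]] by (simp_all add: matrix_inv_def)

lemma dg_G_diagonalization:
  assumes d: "(a - 1) * h\<^sup>2 * lam - 2 \<noteq> 0"
    and inv: "invertible (dg_W lam h a)"
  shows "map_matrix complex_of_real (dg_G lam h (a * h\<^sup>2)) =
    dg_W lam h a ** dg_D lam h a ** matrix_inv (dg_W lam h a)"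
proof -
  define l1 l2 where "l1 = dg_lambda1 lam h a" and "l2 = dg_lambda2 lam h a"
  have den: "lam * (a * h\<^sup>2) - h\<^sup>2 * lam - 2 = (a - 1) * h\<^sup>2 * lam - 2"
    by (simp add: algebra_simps)
  have "dg_G lam h (a * h\<^sup>2) = vector [vector [0, 1],
      vector [(2 + lam * a * h\<^sup>2) / ((a - 1) * h\<^sup>2 * lam - 2), (h\<^sup>2 * lam - 4) / ((a - 1) * h\<^sup>2 * lam - 2)]]"
    unfolding dg_G_def den by (simp only: mult.assoc)
  then have G: "map_matrix complex_of_real (dg_G lam h (a * h\<^sup>2)) =
      vector [vector [0, 1], vector [- (l1 * l2), l1 + l2]]"
    unfolding l1_def l2_def dg_lambda_sum_prod[OF d]
    by (simp add: vec_eq_iff forall_2 map_matrix_def)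
  (* The columns (1, l) of W are eigenvectors of the companion matrix. *)
  have "map_matrix complex_of_real (dg_G lam h (a * h\<^sup>2)) ** dg_W lam h a =
      dg_W lam h a ** dg_D lam h a"
    unfolding G dg_W_def dg_D_def l1_def[symmetric] l2_def[symmetric]
    by (simp add: vec_eq_iff forall_2 matrix_matrix_mult_def sum_2 algebra_simps)
  then show ?thesis
    by (metis inv invertible_matrix_inv(1) matrix_mul_assoc matrix_mul_rid)
qed

section \<open>Stability and convergence\<close>

lemma complex_vec_add: "complex_vec (x + y) = complex_vec x + complex_vec y"
  by (simp add: complex_vec_def vec_eq_iff)

lemma complex_vec_mult:
  "complex_vec (A *v x) = map_matrix complex_of_real A *v complex_vec x"
  by (simp add: complex_vec_def map_matrix_def matrix_vector_mult_def vec_eq_iff)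

lemma norm_complex_vec: "norm (complex_vec x) = norm x"
  by (simp add: complex_vec_def norm_vec_def)

lemma norm_vec2_le:
  fixes x :: "'a::real_normed_vector^2"
  assumes "norm (x $ 1) \<le> B" "norm (x $ 2) \<le> B"
  shows "norm x \<le> 2 * B"
proof -
  have "norm x \<le> (\<Sum>i\<in>UNIV. norm (x $ i))"
    unfolding norm_vec_def by (rule L2_set_le_sum) simp
  then show ?thesis
    using assms by (simp add: sum_2)
qed

text \<open>Since the first component of a truncation error vanishes, its two coordinates in the eigenbasis
  are \<open>\<plusminus> x $ 2 / (\<lambda>\<^sub>1 - \<lambda>\<^sub>2)\<close>.\<close>

lemma dg_W_inv_bound:
  assumes inv: "invertible (dg_W lam h a)" and "x $ 1 = 0"
    and sep: "0 < c" "c \<le> norm (dg_lambda1 lam h a - dg_lambda2 lam h a)"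
    and "norm x \<le> B"
  shows "norm ((matrix_inv (dg_W lam h a) *v complex_vec x) $ i) \<le> B / c"
proof -
  define l1 l2 where "l1 = dg_lambda1 lam h a" and "l2 = dg_lambda2 lam h a"
  define w where "w = matrix_inv (dg_W lam h a) *v complex_vec x"
  have "dg_W lam h a *v w = complex_vec x"
    unfolding w_def by (simp add: matrix_vector_mul_assoc invertible_matrix_inv(1)[OF inv])
  then have "w $ 1 + w $ 2 = 0" "l1 * w $ 1 + l2 * w $ 2 = of_real (x $ 2)"
    using \<open>x $ 1 = 0\<close> unfolding dg_W_mult_vec l1_def l2_def
    by (simp_all add: vec_eq_iff forall_2 complex_vec_def)
  then have w2: "w $ 2 = - w $ 1" and "l1 * w $ 1 + l2 * w $ 2 = of_real (x $ 2)"
    by (simp_all add: add_eq_0_iff)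
  then have w1: "(l1 - l2) * w $ 1 = of_real (x $ 2)"
    by (simp add: algebra_simps)
  have "norm (l1 - l2) * norm (w $ 1) \<le> B"
    using \<open>norm x \<le> B\<close> component_le_norm_cart[of x 2]
    unfolding norm_mult[symmetric] w1 by simp
  moreover have "c * norm (w $ 1) \<le> norm (l1 - l2) * norm (w $ 1)"
    using sep by (intro mult_right_mono) (auto simp: l1_def l2_def)
  ultimately have "norm (w $ 1) \<le> B / c"
    using \<open>0 < c\<close> by (simp add: pos_le_divide_eq mult.commute)
  then show ?thesis
    using w2 exhaust_2[of i] unfolding w_def[symmetric] by auto
qed

text \<open>In the eigenbasis the error recursion decouples, and as no eigenvalue exceeds one in modulus
  the local contributions merely add up. The factor \<open>4\<close> arises on returning by \<open>W\<close>: each of the two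
  components is a sum of two coordinates.\<close>

lemma dg_error_bound:
  assumes inv: "invertible (dg_W lam h a)"
    and diag: "map_matrix complex_of_real G =
      dg_W lam h a ** dg_D lam h a ** matrix_inv (dg_W lam h a)"
    and le_1: "norm (dg_lambda1 lam h a) \<le> 1" "norm (dg_lambda2 lam h a) \<le> 1"
    and rec: "\<And>n. n < N \<Longrightarrow> e (Suc n) = G *v e n + \<theta> n" and "e 0 = 0"
    and \<theta>: "\<And>n i. n < N \<Longrightarrow> norm ((matrix_inv (dg_W lam h a) *v complex_vec (\<theta> n)) $ i) \<le> B"
    and "n \<le> N"
  shows "norm (e n) \<le> 4 * real n * B"
proof -
  let ?W = "dg_W lam h a" and ?D = "dg_D lam h a" and ?V = "matrix_inv (dg_W lam h a)"
  have VW: "?V ** ?W = mat 1" and WV: "?W ** ?V = mat 1"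
    using inv by (simp_all add: invertible_matrix_inv)
  define z where "z n = ?V *v complex_vec (e n)" for n
  have z_Suc: "z (Suc n) = ?D *v z n + ?V *v complex_vec (\<theta> n)" if "n < N" for n
  proof -
    have "z (Suc n) = ?V *v (?W ** ?D ** ?V *v complex_vec (e n)) + ?V *v complex_vec (\<theta> n)"
      by (simp add: z_def rec[OF that] complex_vec_add complex_vec_mult diag
          matrix_vector_right_distrib)
    also have "?V *v (?W ** ?D ** ?V *v complex_vec (e n)) = ?D *v z n"
      by (metis VW matrix_mul_assoc matrix_mul_lid matrix_vector_mul_assoc z_def)
    finally show ?thesis .
  qed
  have z: "norm (z n $ i) \<le> real n * B" if "n \<le> N" for n i
    using that
  proof (induction n)
    case 0
    show ?case
      by (simp add: z_def \<open>e 0 = 0\<close> complex_vec_def matrix_vector_mult_def)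
  next
    case (Suc n)
    have "norm ((?D *v z n) $ i) \<le> norm (z n $ i)"
      using le_1 exhaust_2[of i]
      by (auto simp: dg_D_mult_vec norm_mult mult_left_le_one_le)
    then have "norm (z (Suc n) $ i) \<le>
        norm (z n $ i) + norm ((?V *v complex_vec (\<theta> n)) $ i)"
      using Suc.prems by (simp add: z_Suc norm_triangle_le)
    also have "\<dots> \<le> real n * B + B"
      using Suc.prems by (intro add_mono Suc.IH \<theta>) auto
    finally show ?case
      by (simp add: algebra_simps)
  qed
  have e: "complex_vec (e n) = ?W *v z n"
    by (simp add: z_def matrix_vector_mul_assoc WV)
  have "norm (z n $ 1 + z n $ 2) \<le> 2 * (real n * B)"
    using norm_triangle_ineq[of "z n $ 1" "z n $ 2"] z[OF \<open>n \<le> N\<close>, of 1] z[OF \<open>n \<le> N\<close>, of 2]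
    by linarith
  moreover have "norm (dg_lambda1 lam h a * z n $ 1 + dg_lambda2 lam h a * z n $ 2)
      \<le> 2 * (real n * B)"
  proof -
    have "norm (dg_lambda1 lam h a * z n $ 1) \<le> norm (z n $ 1)"
      using le_1 by (simp add: norm_mult mult_left_le_one_le)
    moreover have "norm (dg_lambda2 lam h a * z n $ 2) \<le> norm (z n $ 2)"
      using le_1 by (simp add: norm_mult mult_left_le_one_le)
    ultimately show ?thesis
      using norm_triangle_ineq[of "dg_lambda1 lam h a * z n $ 1" "dg_lambda2 lam h a * z n $ 2"]
        z[OF \<open>n \<le> N\<close>, of 1] z[OF \<open>n \<le> N\<close>, of 2]
      by linarith
  qed
  ultimately have "norm (?W *v z n) \<le> 2 * (2 * (real n * B))"
    by (intro norm_vec2_le) (simp_all add: dg_W_mult_vec)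
  then show ?thesis
    by (simp add: e[symmetric] norm_complex_vec)
qed

text \<open>The maximum over an empty set is an unspecified value, so the index sets must eventually be
  nonempty.\<close>

lemma bigo_Max:
  fixes f :: "nat \<Rightarrow> nat \<Rightarrow> real"
  assumes "\<forall>\<^sub>F N in sequentially. finite (A N) \<and> A N \<noteq> {} \<and> (\<forall>n\<in>A N. 0 \<le> f N n \<and> f N n \<le> C * g N)"
  shows "(\<lambda>N. MAX n\<in>A N. f N n) \<in> O(g)"
proof (rule bigoI[of _ "\<bar>C\<bar>"])
  show "\<forall>\<^sub>F N in sequentially. norm (MAX n\<in>A N. f N n) \<le> \<bar>C\<bar> * norm (g N)"
    using assms
  proof eventually_elim
    case (elim N)
    then have "(MAX n\<in>A N. f N n) \<in> f N ` A N"
      by (intro Max_in) auto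
    then obtain n where "n \<in> A N" "(MAX n\<in>A N. f N n) = f N n"
      by blast
    then show ?case
      using elim abs_ge_self[of "C * g N"] by (auto simp: abs_mult)
  qed
qed

theorem theorem2:
  fixes lam T a u0_hat u1_hat :: real and p :: nat
    and u u' u'' :: "real \<Rightarrow> real"
    and dt s :: "nat \<Rightarrow> real"
    and u_DG e \<theta> :: "nat \<Rightarrow> nat \<Rightarrow> real^2"
  assumes "lam > 0" and "T > 0"
    and dt: "\<And>N. dt N = T / real N"
    and s: "\<And>N. s N = a * (dt N)\<^sup>2"
    and "\<And>t. (u has_real_derivative u' t) (at t)"
    and "\<And>t. (u' has_real_derivative u'' t) (at t)"
    and ode: "\<And>t. u'' t + lam * u t = 0"
    and "u 0 = u0_hat" and "u' 0 = u1_hat"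
    and scheme: "\<And>N n. N > 0 \<Longrightarrow> n < N \<Longrightarrow> u_DG N (Suc n) = dg_G lam (dt N) (s N) *v u_DG N n"
    and e: "\<And>N n. e N n = u_ex u (dt N) n - u_DG N n"
    and e_0: "\<And>N. N > 0 \<Longrightarrow> e N 0 = 0"
    and \<theta>: "\<And>N n. \<theta> N n = u_ex u (dt N) (Suc n) - dg_G lam (dt N) (s N) *v u_ex u (dt N) n"
    and p: "p = 2 \<and> (\<forall>\<^sub>F N in sequentially. a \<in> {0} \<union> {1/2 - 2 / (dt N * sqrt lam) <..< 1/2}) \<or>
            p = 3 \<and> a = 1/2"
  shows "(\<forall>N>0. \<forall>n<N. e N (Suc n) = dg_G lam (dt N) (s N) *v e N n + \<theta> N n) \<and>
    (\<forall>\<^sub>F N in sequentially. invertible (dg_W lam (dt N) a) \<and>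
       map_matrix complex_of_real (dg_G lam (dt N) (s N)) =
         dg_W lam (dt N) a ** dg_D lam (dt N) a ** matrix_inv (dg_W lam (dt N) a)) \<and>
    (\<lambda>N. MAX n\<in>{..<N}. norm (\<theta> N n)) \<in> O(\<lambda>N. dt N ^ (p + 1)) \<and>
    (\<lambda>N. MAX n\<in>{..<N}. norm (matrix_inv (dg_W lam (dt N) a) *v complex_vec (\<theta> N n)))
       \<in> O(\<lambda>N. dt N ^ p) \<and>
    (\<lambda>N. MAX n\<in>{..N}. norm (e N n)) \<in> O(\<lambda>N. dt N ^ (p - 1))"
proof (intro conjI)
  (* Every admissible a lies at or below 1/2, the upper end of the stability interval. *)
  have "\<exists>N. a \<in> {0} \<union> {1/2 - 2 / (dt N * sqrt lam) <..< 1/2}" if "p = 2"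
    using p that by (auto dest!: eventually_happens)
  then have a: "a \<le> 1/2"
    using p by auto
  show rec: "\<forall>N>0. \<forall>n<N. e N (Suc n) = dg_G lam (dt N) (s N) *v e N n + \<theta> N n"
    by (simp add: e \<theta> scheme matrix_vector_mult_diff_distrib)

  obtain C where C: "\<And>h n. 0 < h \<Longrightarrow> h \<le> 1 \<Longrightarrow>
      norm (u_ex u h (Suc n) - dg_G lam h (a * h\<^sup>2) *v u_ex u h n) \<le> C * h ^ (p + 1)"
    using truncation_error[OF assms(1,5,6) ode, of p a] a p by auto
  define c where "c = sqrt (8 * lam) / 3"
  have "c > 0"
    using \<open>lam > 0\<close> by (simp add: c_def)

  (* The last two conditions are those under which the eigenvalues are known to be separated;
     both hold eventually because their left-hand sides tend to zero. *)
  define fine_grid where "fine_grid N \<longleftrightarrow> 0 < N \<and> 0 < dt N \<and> dt N \<le> 1 \<and>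
      (4 * a\<^sup>2 - 4 * a + 1) * (dt N)\<^sup>2 * lam\<^sup>2 \<le> 8 * lam \<and> (1 - a) * (dt N)\<^sup>2 * lam \<le> 1" for N
  have dt_lim: "dt \<longlonglongrightarrow> 0"
    unfolding dt[abs_def] by (rule lim_const_over_n)
  have "\<forall>\<^sub>F N in sequentially. (4 * a\<^sup>2 - 4 * a + 1) * (dt N)\<^sup>2 * lam\<^sup>2 < 8 * lam"
    by (rule order_tendstoD(2)[of _ 0])
       (use \<open>lam > 0\<close> in \<open>auto intro!: tendsto_eq_intros dt_lim\<close>)
  moreover have "\<forall>\<^sub>F N in sequentially. (1 - a) * (dt N)\<^sup>2 * lam < 1"
    by (rule order_tendstoD(2)[of _ 0]) (auto intro!: tendsto_eq_intros dt_lim)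
  moreover have "\<forall>\<^sub>F N in sequentially. dt N < 1"
    by (rule order_tendstoD(2)[OF dt_lim]) simp
  moreover have "\<forall>\<^sub>F N in sequentially. N > 0"
    by (rule eventually_gt_at_top)
  ultimately have small: "\<forall>\<^sub>F N in sequentially. fine_grid N"
    by eventually_elim (use \<open>T > 0\<close> in \<open>auto simp: fine_grid_def dt\<close>)

  have estimates: "invertible (dg_W lam (dt N) a) \<and>
      map_matrix complex_of_real (dg_G lam (dt N) (s N)) =
        dg_W lam (dt N) a ** dg_D lam (dt N) a ** matrix_inv (dg_W lam (dt N) a) \<and>
      (\<forall>n. norm (\<theta> N n) \<le> C * dt N ^ (p + 1)) \<and>
      (\<forall>n i. norm ((matrix_inv (dg_W lam (dt N) a) *v complex_vec (\<theta> N n)) $ i)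
        \<le> C / c * dt N ^ p) \<and>
      (\<forall>n\<le>N. norm (e N n) \<le> 4 * T * C / c * dt N ^ (p - 1))"
    if "fine_grid N" for N
  proof -
    note N = that[unfolded fine_grid_def]
    have sep: "c * dt N \<le> norm (dg_lambda1 lam (dt N) a - dg_lambda2 lam (dt N) a)"
      unfolding c_def using N \<open>lam > 0\<close> a by (intro dg_lambda_separated) auto
    have cdt: "0 < c * dt N"
      using N \<open>c > 0\<close> by simp
    have inv: "invertible (dg_W lam (dt N) a)"
      using sep cdt by (intro invertible_dg_W) auto
    have diag: "map_matrix complex_of_real (dg_G lam (dt N) (s N)) =
        dg_W lam (dt N) a ** dg_D lam (dt N) a ** matrix_inv (dg_W lam (dt N) a)"
      unfolding s using dg_denominator_le[OF \<open>lam > 0\<close> a, of "dt N"]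
      by (intro dg_G_diagonalization inv) linarith
    have \<theta>_le: "norm (\<theta> N n) \<le> C * dt N ^ (p + 1)" for n
      unfolding \<theta> s using N by (intro C) auto
    have \<theta>_1: "\<theta> N n $ 1 = 0" for n
      by (simp add: \<theta> dg_G_mult_vec u_ex_def)
    have W\<theta>_le: "norm ((matrix_inv (dg_W lam (dt N) a) *v complex_vec (\<theta> N n)) $ i)
        \<le> C / c * dt N ^ p" for n i
      using dg_W_inv_bound[OF inv \<theta>_1 cdt sep \<theta>_le, of n i] N by simp
    have "norm (e N n) \<le> 4 * T * C / c * dt N ^ (p - 1)" if "n \<le> N" for n
    proof -
      have "0 \<le> C / c * dt N ^ p"
        using W\<theta>_le by (rule order_trans[OF norm_ge_zero])
      have "norm (dg_lambda1 lam (dt N) a) \<le> 1" "norm (dg_lambda2 lam (dt N) a) \<le> 1"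
        using N \<open>lam > 0\<close> a by (intro norm_dg_lambda_le_1; linarith)+
      then have "norm (e N n) \<le> 4 * real n * (C / c * dt N ^ p)"
        using N rec e_0 W\<theta>_le \<open>n \<le> N\<close>
        by (intro dg_error_bound[OF inv diag, where N = N and \<theta> = "\<theta> N"]) auto
      also have "\<dots> \<le> 4 * real N * (C / c * dt N ^ p)"
        using \<open>n \<le> N\<close> \<open>0 \<le> C / c * dt N ^ p\<close> by (intro mult_right_mono) auto
      (* One factor dt N is spent on turning the number of steps into the final time T. *)
      also have "\<dots> = 4 * (real N * dt N) * C / c * dt N ^ (p - 1)"
        using p by (auto simp: eval_nat_numeral)
      also have "real N * dt N = T"
        using N by (simp add: dt)
      finally show ?thesis .
    qed
    then show ?thesis
      using inv diag \<theta>_le W\<theta>_le by blast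
  qed

  show "\<forall>\<^sub>F N in sequentially. invertible (dg_W lam (dt N) a) \<and>
       map_matrix complex_of_real (dg_G lam (dt N) (s N)) =
         dg_W lam (dt N) a ** dg_D lam (dt N) a ** matrix_inv (dg_W lam (dt N) a)"
    using small by eventually_elim (use estimates in blast)
  have nonempty: "{..<N} \<noteq> {}" "{..N} \<noteq> {}" if "fine_grid N" for N
    using that by (auto simp: fine_grid_def lessThan_empty_iff)
  show "(\<lambda>N. MAX n\<in>{..<N}. norm (\<theta> N n)) \<in> O(\<lambda>N. dt N ^ (p + 1))"
    using small by (intro bigo_Max[where C = C], eventually_elim) (use estimates nonempty in auto)
  have W\<theta>: "norm (matrix_inv (dg_W lam (dt N) a) *v complex_vec (\<theta> N n)) \<le> 2 * C / c * dt N ^ p"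
    if "fine_grid N" for N n
    using norm_vec2_le[of "matrix_inv (dg_W lam (dt N) a) *v complex_vec (\<theta> N n)"
        "C / c * dt N ^ p"] estimates[OF that] by auto
  show "(\<lambda>N. MAX n\<in>{..<N}. norm (matrix_inv (dg_W lam (dt N) a) *v complex_vec (\<theta> N n)))
       \<in> O(\<lambda>N. dt N ^ p)"
    using small by (intro bigo_Max[where C = "2 * C / c"], eventually_elim) (use W\<theta> nonempty in auto)
  show "(\<lambda>N. MAX n\<in>{..N}. norm (e N n)) \<in> O(\<lambda>N. dt N ^ (p - 1))"
    using small by (intro bigo_Max[where C = "4 * T * C / c"], eventually_elim) (use estimates nonempty in auto)
qed

end
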